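(* Let $K$ be a field, $V$ a vector space over $K$, $\sigma$ an automorphism of $K$, $\beta:V\times V\to K$ a reflexive $\sigma$-sesquilinear form, and $Q:V\to K$ a quadratic form. Let $F$ be a subfield of $K$ with $\sigma(F)=F$, and let $L:K\to F$ be an $F$-linear function. Regard $V$ as a vector space over $F$ and consider the composed forms $L\beta=L\circ\beta:V\times V\to F$ and $LQ=L\circ Q:V\to F$. Then: (1) $L\beta$ is non-degenerate if and only if $\beta$ is non-degenerate and $L\neq 0$. (2) If $\operatorname{char} K\neq 2$, or if $K=GF(2^h)$ for some integer $h$ and $\dim_K V$ is even, then $LQ$ is non-degenerate if and only if $Q$ is non-degenerate and $L\neq 0$. (3) If $K=GF(2^h)$ for some integer $h$ and $\dim_K V$ is odd, then $LQ$ is degenerate.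
   Context: A $\sigma$-sesquilinear form $\beta:V\times V\to K$ is biadditive with $\beta(\lambda u,\mu v)=\lambda\,\sigma(\mu)\,\beta(u,v)$ for all $\lambda,\mu\in K$, $u,v\in V$ ($\sigma$ may be the identity, in which case $\beta$ is bilinear). It is reflexive if $\beta(u,v)=0$ implies $\beta(v,u)=0$. The polar form of a quadratic form $Q$ is $f_Q(u,v)=Q(u+v)-Q(u)-Q(v)$. The condition $\sigma(F)=F$ ensures that $L\beta$ is a sesquilinear form over $F$ (with respect to $\sigma|_F$); $LQ$ is a quadratic form over $F$ with polar form $Lf_Q$. A $\sigma$-sesquilinear form $\beta$ is non-degenerate if ($\beta(u,v)=0$ for all $v\in V$) implies $u=0$. A quadratic form $Q$ is non-degenerate if ($Q(u)=0$ and $f_Q(u,v)=0$ for all $v\in V$) implies $u=0$. Forms are degenerate otherwise. "$\dim_K V$ even" and "$\dim_K V$ odd" mean in particular that $\dim_K V$ is finite. $GF(q)$ denotes the finite field with $q$ elements.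
   Formalization: V is assumed nonzero (for V=0, L=0 the forms are vacuously non-degenerate, so (1) and (2) fail), and in (3) F is assumed to be a proper subfield of K (for F=K=V=GF(2), L=id, Q(x)=x^2, LQ is non-degenerate). *)

theory Defs
  imports Complex_Main "HOL-Library.Cardinality" "HOL-Computational_Algebra.Computational_Algebra"
begin

text \<open>
  The field \<open>K\<close> is a type \<open>'k :: field\<close>; the space \<open>V\<close> is a type \<open>'v :: ab_group_add\<close> with a
  scalar multiplication \<open>scl\<close> satisfying \<open>vector_space scl\<close>. A subfield \<open>F\<close> is a subset of
  \<open>'k\<close>, and the \<open>F\<close>-space underlying \<open>V\<close> is obtained by restricting \<open>scl\<close> to scalars in \<open>F\<close>.
  Forms over \<open>F\<close> are accordingly \<open>'k\<close>-valued functions with all values in \<open>F\<close>; forms over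
  \<open>K\<close> are the case \<open>F = UNIV\<close>.
\<close>

definition is_subfield :: "'k::field set \<Rightarrow> bool" where
  "is_subfield F \<longleftrightarrow> 0 \<in> F \<and> 1 \<in> F \<and>
     (\<forall>x\<in>F. \<forall>y\<in>F. x + y \<in> F \<and> x * y \<in> F) \<and>
     (\<forall>x\<in>F. - x \<in> F \<and> inverse x \<in> F)"

definition field_automorphism :: "('k::field \<Rightarrow> 'k) \<Rightarrow> bool" where
  "field_automorphism \<sigma> \<longleftrightarrow> bij \<sigma> \<and> \<sigma> 1 = 1 \<and>
     (\<forall>x y. \<sigma> (x + y) = \<sigma> x + \<sigma> y) \<and> (\<forall>x y. \<sigma> (x * y) = \<sigma> x * \<sigma> y)"

definition linear_map_to_subfield :: "'k::field set \<Rightarrow> ('k \<Rightarrow> 'k) \<Rightarrow> bool" where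
  "linear_map_to_subfield F L \<longleftrightarrow> range L \<subseteq> F \<and>
     (\<forall>x y. L (x + y) = L x + L y) \<and> (\<forall>c\<in>F. \<forall>x. L (c * x) = c * L x)"

definition sesquilinear_form ::
  "'k::field set \<Rightarrow> ('k \<Rightarrow> 'v::ab_group_add \<Rightarrow> 'v) \<Rightarrow> ('k \<Rightarrow> 'k) \<Rightarrow> ('v \<Rightarrow> 'v \<Rightarrow> 'k) \<Rightarrow> bool"
where
  "sesquilinear_form F scl \<sigma> \<beta> \<longleftrightarrow>
     (\<forall>u v. \<beta> u v \<in> F) \<and>
     (\<forall>u u' v. \<beta> (u + u') v = \<beta> u v + \<beta> u' v) \<and>
     (\<forall>u v v'. \<beta> u (v + v') = \<beta> u v + \<beta> u v') \<and>
     (\<forall>a\<in>F. \<forall>b\<in>F. \<forall>u v. \<beta> (scl a u) (scl b v) = a * \<sigma> b * \<beta> u v)"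

definition reflexive_form :: "('v \<Rightarrow> 'v \<Rightarrow> 'k::zero) \<Rightarrow> bool" where
  "reflexive_form \<beta> \<longleftrightarrow> (\<forall>u v. \<beta> u v = 0 \<longrightarrow> \<beta> v u = 0)"

definition polar_form :: "('v::ab_group_add \<Rightarrow> 'k::field) \<Rightarrow> 'v \<Rightarrow> 'v \<Rightarrow> 'k" where
  "polar_form Q u v = Q (u + v) - Q u - Q v"

definition quadratic_form ::
  "'k::field set \<Rightarrow> ('k \<Rightarrow> 'v::ab_group_add \<Rightarrow> 'v) \<Rightarrow> ('v \<Rightarrow> 'k) \<Rightarrow> bool"
where
  "quadratic_form F scl Q \<longleftrightarrow>
     (\<forall>u. Q u \<in> F) \<and>
     (\<forall>a\<in>F. \<forall>u. Q (scl a u) = a\<^sup>2 * Q u) \<and>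
     sesquilinear_form F scl id (polar_form Q)"

definition nondegenerate_form :: "('v::ab_group_add \<Rightarrow> 'v \<Rightarrow> 'k::field) \<Rightarrow> bool" where
  "nondegenerate_form \<beta> \<longleftrightarrow> (\<forall>u. (\<forall>v. \<beta> u v = 0) \<longrightarrow> u = 0)"

definition nondegenerate_quadratic_form :: "('v::ab_group_add \<Rightarrow> 'k::field) \<Rightarrow> bool" where
  "nondegenerate_quadratic_form Q \<longleftrightarrow>
     (\<forall>u. Q u = 0 \<and> (\<forall>v. polar_form Q u v = 0) \<longrightarrow> u = 0)"

text \<open>
  On \<open>V = 0\<close> every form is non-degenerate, even the zero form \<open>L \<circ> \<beta>\<close> for \<open>L = 0\<close>; on
  \<open>V = F = K = GF(2)\<close> with \<open>L = id\<close>, the form \<open>Q x = x\<^sup>2\<close> has polar form \<open>0\<close> and is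
  non-degenerate although the dimension is odd. Hence the theorem requires \<open>V \<noteq> 0\<close>, and
  its odd-dimensional part a proper subfield \<open>F\<close>.
\<close>

text \<open>
  The library dimension of an infinite-dimensional space is \<open>0\<close>, so finiteness has to be
  required separately.
\<close>

definition finite_dim :: "('k::field \<Rightarrow> 'v::ab_group_add \<Rightarrow> 'v) \<Rightarrow> bool" where
  "finite_dim scl \<longleftrightarrow> (\<exists>B. finite_dimensional_vector_space scl B)"

definition even_dim :: "('k::field \<Rightarrow> 'v::ab_group_add \<Rightarrow> 'v) \<Rightarrow> bool" where
  "even_dim scl \<longleftrightarrow> finite_dim scl \<and> even (vector_space.dim scl (UNIV :: 'v set))"

definition odd_dim :: "('k::field \<Rightarrow> 'v::ab_group_add \<Rightarrow> 'v) \<Rightarrow> bool" where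
  "odd_dim scl \<longleftrightarrow> finite_dim scl \<and> odd (vector_space.dim scl (UNIV :: 'v set))"

text \<open>
  A field with \<open>2 ^ h\<close> elements is \<open>GF(2\<^sup>h)\<close>. An infinite type has \<open>CARD = 0\<close>, which is not a
  power of \<open>2\<close>, so finiteness is implied.
\<close>

definition is_GF_two_power :: "'k::field itself \<Rightarrow> bool" where
  "is_GF_two_power _ \<longleftrightarrow> (\<exists>h::nat. CARD('k) = 2 ^ h)"

text \<open>The composed forms are forms over \<open>F\<close>, and taking polar forms commutes with composing.\<close>

lemma sesquilinear_form_compose:
  assumes "sesquilinear_form UNIV scl \<sigma> \<beta>" "is_subfield F" "\<sigma> ` F = F"
    and "linear_map_to_subfield F L"
  shows "sesquilinear_form F scl \<sigma> (\<lambda>u v. L (\<beta> u v))"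
proof -
  have F: "a * \<sigma> b \<in> F" if "a \<in> F" "b \<in> F" for a b
  proof -
    have "\<sigma> b \<in> F" using that(2) assms(3) by blast
    then show ?thesis using that(1) assms(2) by (simp add: is_subfield_def)
  qed
  have L: "L x \<in> F" "L (x + y) = L x + L y" for x y
    using assms(4) by (auto simp: linear_map_to_subfield_def)
  have Lc: "L (c * x) = c * L x" if "c \<in> F" for c x
    using that assms(4) by (simp add: linear_map_to_subfield_def)
  have \<beta>: "\<beta> (scl a u) (scl b v) = a * \<sigma> b * \<beta> u v" "\<beta> (u + u') v = \<beta> u v + \<beta> u' v"
      "\<beta> u (v + v') = \<beta> u v + \<beta> u v'" for a b u u' v v'
    using assms(1) by (simp_all add: sesquilinear_form_def)
  show ?thesis
    unfolding sesquilinear_form_def by (intro conjI allI ballI) (simp_all only: \<beta> L Lc F)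
qed

lemma polar_form_compose:
  assumes "linear_map_to_subfield F L"
  shows "polar_form (\<lambda>u. L (Q u)) = (\<lambda>u v. L (polar_form Q u v))"
proof -
  have "L (x + y) = L x + L y" for x y
    using assms by (simp add: linear_map_to_subfield_def)
  then interpret additive L
    by unfold_locales
  show ?thesis
    by (intro ext) (simp add: polar_form_def diff)
qed

lemma quadratic_form_compose:
  assumes "quadratic_form UNIV scl Q" "is_subfield F" "linear_map_to_subfield F L"
  shows "quadratic_form F scl (\<lambda>u. L (Q u))"
proof -
  have "sesquilinear_form F scl id (\<lambda>u v. L (polar_form Q u v))"
    by (rule sesquilinear_form_compose[OF _ assms(2) _ assms(3)])
      (use assms(1) in \<open>simp_all add: quadratic_form_def\<close>)
  moreover have "L (Q u) \<in> F" for u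
    using assms(3) by (auto simp: linear_map_to_subfield_def)
  moreover have "L (Q (scl a u)) = a\<^sup>2 * L (Q u)" if "a \<in> F" for a u
  proof -
    have "a\<^sup>2 \<in> F" using that assms(2) by (simp add: is_subfield_def power2_eq_square)
    moreover have "Q (scl a u) = a\<^sup>2 * Q u" using assms(1) by (simp add: quadratic_form_def)
    ultimately show ?thesis using assms(3) by (simp add: linear_map_to_subfield_def)
  qed
  ultimately show ?thesis
    by (simp add: quadratic_form_def polar_form_compose[OF assms(3)])
qed

end

theory Submission
  imports Defs "HOL-Number_Theory.Residues"
begin

text \<open>
  If \<open>u\<close> is not in the radical of \<open>\<beta>\<close>, then \<open>\<beta> u\<close> takes every value in \<open>K\<close>, so composing with
  a non-zero \<open>L\<close> does not enlarge the radical of \<open>\<beta>\<close>. This gives (1), and (2) whenever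
  non-degeneracy of \<open>Q\<close> is the same as non-degeneracy of its polar form. In characteristic other than 2
  this holds because \<open>f\<^sub>Q(u, u) = 2 Q(u)\<close>. In characteristic 2 the polar form is alternating,
  so its radical \<open>R\<close> has the same parity of dimension as \<open>V\<close>. On \<open>R\<close> the form \<open>Q\<close> is additive,
  and since all elements of \<open>GF(2\<^sup>h)\<close> are squares, \<open>Q\<close> is isotropic on \<open>R\<close> if \<open>dim R \<ge> 2\<close>.
  Hence \<open>R = 0\<close> if \<open>Q\<close> is non-degenerate and \<open>dim V\<close> is even. If \<open>dim V\<close> is odd,
  there is \<open>0 \<noteq> u \<in> R\<close>, and unless \<open>Q(u) = 0\<close>, the values of \<open>Q\<close> on \<open>K u\<close> fill \<open>K\<close> and so meet
  the kernel of \<open>L\<close> outside \<open>0\<close>.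
\<close>

section \<open>Finite fields of characteristic 2 and their square roots\<close>

lemma is_GF_two_power_CHAR:
  assumes "is_GF_two_power TYPE('k::field)"
  shows "finite (UNIV :: 'k set)" "CHAR('k) = 2"
proof -
  obtain h where h: "CARD('k) = 2 ^ h"
    using assms by (auto simp: is_GF_two_power_def)
  show fin: "finite (UNIV :: 'k set)"
    by (rule card_ge_0_finite) (simp add: h)
  have "CHAR('k) > 0"
    using fin by (intro finite_imp_CHAR_pos)
  then have p: "prime CHAR('k)"
    by (intro prime_CHAR_semidom)
  have "CHAR('k) dvd 2 ^ h"
    using CHAR_dvd_CARD[where ?'a = 'k] by (simp add: h)
  then have "CHAR('k) dvd 2"
    using p prime_dvd_power by blast
  then show "CHAR('k) = 2"
    using p by (simp add: primes_dvd_imp_eq)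
qed

lemma CHAR_eq_2_iff: "CHAR('k::field) = 2 \<longleftrightarrow> (2 :: 'k) = 0"
proof
  assume "CHAR('k) = 2"
  then show "(2 :: 'k) = 0"
    using of_nat_CHAR[where ?'a = 'k] by simp
next
  assume "(2 :: 'k) = 0"
  then have "of_nat 2 = (0 :: 'k)"
    by simp
  then have "CHAR('k) dvd 2"
    by (simp only: of_nat_eq_0_iff_char_dvd)
  then have "CHAR('k) = 1 \<or> CHAR('k) = 2"
    using two_is_prime_nat prime_nat_iff by blast
  then show "CHAR('k) = 2"
    using CHAR_not_1' by auto
qed

text \<open>Since \<open>- b = b\<close>, squaring is injective, hence surjective on a finite
  field.\<close>

lemma finite_CHAR_2_square_root:
  fixes c :: "'k::field"
  assumes "finite (UNIV :: 'k set)" "(2 :: 'k) = 0"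
  shows "\<exists>a. a\<^sup>2 = c"
proof -
  have "inj (\<lambda>a::'k. a\<^sup>2)"
  proof (rule injI)
    fix a b :: 'k
    assume "a\<^sup>2 = b\<^sup>2"
    then have "a = b \<or> a = - b"
      by (simp add: power2_eq_iff)
    moreover have "b + b = 0"
      using assms(2) by (metis mult_2 mult_zero_left)
    ultimately show "a = b"
      by (metis minus_unique)
  qed
  then have "surj (\<lambda>a::'k. a\<^sup>2)"
    using assms(1) by (intro finite_UNIV_inj_surj)
  then show ?thesis
    by (metis surjD)
qed

section \<open>Radicals under composition with \<open>L\<close>\<close>

context vector_space
begin

lemma sesquilinear_scale_right:
  assumes "sesquilinear_form UNIV scale \<sigma> \<beta>"
  shows "\<beta> u (b *s v) = \<sigma> b * \<beta> u v"
  using assms unfolding sesquilinear_form_def by (metis UNIV_I mult_1 scale_one)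

text \<open>As \<open>\<sigma>\<close> is onto, a value \<open>\<beta> u v \<noteq> 0\<close> can be
  scaled to an element \<open>c\<close> with \<open>L c \<noteq> 0\<close>. A nonzero vector is what
  excludes \<open>L = 0\<close>.\<close>

lemma nondegenerate_form_compose_iff:
  fixes \<beta> :: "'b \<Rightarrow> 'b \<Rightarrow> 'a" and L :: "'a \<Rightarrow> 'a"
  assumes \<beta>: "sesquilinear_form UNIV scale \<sigma> \<beta>" and "surj \<sigma>" "\<exists>v::'b. v \<noteq> 0" "L 0 = 0"
  shows "nondegenerate_form (\<lambda>u v. L (\<beta> u v)) \<longleftrightarrow> nondegenerate_form \<beta> \<and> L \<noteq> (\<lambda>_. 0)"
proof (intro iffI conjI)
  assume nd: "nondegenerate_form (\<lambda>u v. L (\<beta> u v))"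
  show "nondegenerate_form \<beta>"
    using nd \<open>L 0 = 0\<close> by (auto simp: nondegenerate_form_def)
  show "L \<noteq> (\<lambda>_. 0)"
    using nd assms(3) by (auto simp: nondegenerate_form_def)
next
  assume nd: "nondegenerate_form \<beta> \<and> L \<noteq> (\<lambda>_. 0)"
  then obtain c where c: "L c \<noteq> 0"
    by auto
  show "nondegenerate_form (\<lambda>u v. L (\<beta> u v))"
    unfolding nondegenerate_form_def
  proof (intro allI impI, rule ccontr)
    fix u assume u: "\<forall>v. L (\<beta> u v) = 0" "u \<noteq> 0"
    then obtain v where v: "\<beta> u v \<noteq> 0"
      using nd by (auto simp: nondegenerate_form_def)
    obtain b where "\<sigma> b = c / \<beta> u v"
      using \<open>surj \<sigma>\<close> by (metis surjD)
    then have "\<beta> u (b *s v) = c"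
      using v by (simp add: sesquilinear_scale_right[OF \<beta>])
    then show False
      using u(1) c by metis
  qed
qed

lemma polar_form_self:
  assumes "quadratic_form UNIV scale Q"
  shows "polar_form Q u u = 2 * Q u"
proof -
  have "Q (u + u) = Q (2 *s u)"
    by (metis one_add_one scale_left_distrib scale_one)
  also have "\<dots> = 2\<^sup>2 * Q u"
    using assms by (simp add: quadratic_form_def)
  finally show ?thesis
    by (simp add: polar_form_def)
qed

end

text \<open>This direction is free of conditions on characteristic and dimension. The converse has
  to go through the polar form, since \<open>L\<close> may vanish at a nonzero
  \<open>Q u\<close>.\<close>

lemma nondegenerate_quadratic_form_composeD:
  fixes Q :: "'v::ab_group_add \<Rightarrow> 'k::field"
  assumes "linear_map_to_subfield F L" "L 0 = 0" "\<exists>v::'v. v \<noteq> 0"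
    and "nondegenerate_quadratic_form (\<lambda>u. L (Q u))"
  shows "nondegenerate_quadratic_form Q" "L \<noteq> (\<lambda>_. 0)"
  using assms
  by (auto simp: nondegenerate_quadratic_form_def polar_form_compose[OF assms(1)])

lemma nondegenerate_quadratic_form_if_polar:
  "nondegenerate_form (polar_form Q) \<Longrightarrow> nondegenerate_quadratic_form Q"
  by (simp add: nondegenerate_form_def nondegenerate_quadratic_form_def)

section \<open>Dimension parity of the radical of an alternating form\<close>

context finite_dimensional_vector_space
begin

text \<open>Subtracting \<open>(g x / g u) *s u\<close> moves any \<open>x\<close> in
  \<open>S\<close> into the kernel, so \<open>u\<close> together with the kernel spans
  \<open>S\<close>. Two applications cut out the orthogonal complement of a pair of vectors.\<close>

lemma dim_kernel_functional:
  assumes S: "subspace S" and u: "u \<in> S" "g u \<noteq> 0"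
    and g: "\<And>x y. g (x + y) = g x + g y" "\<And>a x. g (a *s x) = a * g x"
  shows "subspace {w \<in> S. g w = 0}" "dim S = Suc (dim {w \<in> S. g w = 0})"
proof -
  let ?T = "{w \<in> S. g w = 0}"
  have g0: "g 0 = 0"
    using g(2)[of 0 0] by simp
  show T: "subspace ?T"
    using S by (auto simp: subspace_def g g0)
  have "S \<subseteq> span (insert u ?T)"
  proof
    fix x assume x: "x \<in> S"
    have "g (x - (g x / g u) *s u) = 0"
      using g(1)[of "x - (g x / g u) *s u" "(g x / g u) *s u"] u(2) by (simp add: g(2))
    then have "x - (g x / g u) *s u \<in> ?T"
      using S x u(1) by (simp add: subspace_diff subspace_scale)
    then show "x \<in> span (insert u ?T)"
      unfolding span_insert by (blast intro: span_base)
  qed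
  moreover have "insert u ?T \<subseteq> S"
    using u(1) by auto
  ultimately have "dim S = dim (insert u ?T)"
    by (metis dim_span S span_subspace)
  also have "\<dots> = Suc (dim ?T)"
    using u(2) by (simp add: dim_insert span_eq_iff[THEN iffD2, OF T])
  finally show "dim S = Suc (dim ?T)" .
qed

text \<open>
  Split off a hyperbolic plane: if \<open>\<beta> u v \<noteq> 0\<close>, the orthogonal complement of \<open>u, v\<close> in \<open>S\<close> has
  codimension 2 and the same radical as \<open>S\<close>.
\<close>

lemma even_dim_radical_alternating:
  assumes \<beta>: "sesquilinear_form UNIV scale id \<beta>" and alt: "\<And>x. \<beta> x x = 0"
    and S: "subspace S"
  shows "even (dim {x \<in> S. \<forall>y\<in>S. \<beta> x y = 0}) \<longleftrightarrow> even (dim S)"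
  using S
proof (induction "dim S" arbitrary: S rule: less_induct)
  case less
  have add: "\<beta> (x + x') y = \<beta> x y + \<beta> x' y" "\<beta> x (y + y') = \<beta> x y + \<beta> x y'" for x x' y y'
    using \<beta> by (simp_all add: sesquilinear_form_def)
  have scl: "\<beta> x (a *s y) = a * \<beta> x y" for a x y
    using sesquilinear_scale_right[OF \<beta>] by simp
  have neg: "\<beta> y x = - \<beta> x y" for x y
  proof -
    have "\<beta> y x + \<beta> x y = \<beta> (x + y) (x + y)"
      by (simp only: add) (simp add: alt)
    also have "\<dots> = 0"
      by (rule alt)
    finally show ?thesis
      by (simp only: eq_neg_iff_add_eq_0)
  qed
  show ?case
  proof (cases "\<forall>x\<in>S. \<forall>y\<in>S. \<beta> x y = 0")
    case True
    then have "{x \<in> S. \<forall>y\<in>S. \<beta> x y = 0} = S"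
      by auto
    then show ?thesis
      by simp
  next
    case False
    then obtain u v where uv: "u \<in> S" "v \<in> S" "\<beta> u v \<noteq> 0"
      by auto
    define T where "T = {w \<in> S. \<beta> u w = 0}"
    define U where "U = {w \<in> T. \<beta> v w = 0}"
    have T: "subspace T" "dim S = Suc (dim T)"
      unfolding T_def using less.prems uv by (intro dim_kernel_functional; simp add: add scl)+
    \<comment> \<open>Because \<open>\<beta> u u = 0\<close>, the vector \<open>u\<close> survives
      in \<open>T\<close> and witnesses that the second functional \<open>\<beta> v\<close> is
      nonzero there.\<close>
    have u: "u \<in> T" "\<beta> v u \<noteq> 0"
      using uv alt neg[of v u] by (auto simp: T_def)
    have U: "subspace U" "dim T = Suc (dim U)"
      unfolding U_def using T(1) u by (intro dim_kernel_functional[of _ u]; simp add: add scl)+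
    have "\<beta> w x = 0" if w: "w \<in> U" "\<forall>y\<in>U. \<beta> w y = 0" and x: "x \<in> S" for w x
    proof -
      \<comment> \<open>The coefficients make \<open>z\<close> the component of \<open>x\<close>
        orthogonal to \<open>u\<close> and \<open>v\<close>: the \<open>v\<close> term cancels
        \<open>\<beta> u x\<close>, the \<open>u\<close> term cancels \<open>\<beta> v x\<close>.
        Then \<open>w\<close> is orthogonal to \<open>z\<close>, \<open>u\<close> and
        \<open>v\<close>, hence to \<open>x\<close>.\<close>
      define a where "a = \<beta> u x / \<beta> u v"
      define b where "b = \<beta> v x / \<beta> v u"
      define z where "z = x + (- a) *s v + (- b) *s u"
      have "z \<in> S"
        unfolding z_def using less.prems uv x by (intro subspace_add subspace_scale)
      moreover have "\<beta> u z = 0" "\<beta> v z = 0"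
        using uv(3) u(2) by (simp_all only: z_def add scl alt a_def b_def) simp_all
      ultimately have "z \<in> U"
        by (simp add: U_def T_def)
      then have "\<beta> w z = 0"
        using w(2) by blast
      moreover have "\<beta> w u = 0" "\<beta> w v = 0"
        using w(1) neg[of w u] neg[of w v] by (auto simp: U_def T_def)
      ultimately show ?thesis
        by (simp only: z_def add scl) simp
    qed
    moreover have "U \<subseteq> S"
      by (auto simp: U_def T_def)
    \<comment> \<open>Conversely, a radical vector of \<open>S\<close> is orthogonal to
      \<open>u\<close> and \<open>v\<close>, with \<open>neg\<close> swapping the arguments.\<close>
    moreover have "x \<in> U" if "x \<in> S" "\<forall>y\<in>S. \<beta> x y = 0" for x
      using that uv neg[of x u] neg[of x v] by (auto simp: U_def T_def)
    ultimately have "{x \<in> S. \<forall>y\<in>S. \<beta> x y = 0} = {x \<in> U. \<forall>y\<in>U. \<beta> x y = 0}"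
      by blast
    moreover have "even (dim {x \<in> U. \<forall>y\<in>U. \<beta> x y = 0}) \<longleftrightarrow> even (dim U)"
      using U T by (intro less.hyps) simp_all
    ultimately show ?thesis
      using U(2) T(2) by simp
  qed
qed

section \<open>The radical of the polar form in characteristic 2\<close>

lemma even_dim_polar_radical:
  fixes Q :: "'b \<Rightarrow> 'a"
  assumes Q: "quadratic_form UNIV scale Q" and "(2 :: 'a) = 0"
  shows "even (dim {x. \<forall>y. polar_form Q x y = 0}) \<longleftrightarrow> even (dim (UNIV :: 'b set))"
proof -
  have "sesquilinear_form UNIV scale id (polar_form Q)"
    using Q by (simp add: quadratic_form_def)
  moreover have "polar_form Q x x = 0" for x
    using polar_form_self[OF Q] assms(2) by simp
  ultimately show ?thesis
    using even_dim_radical_alternating[of "polar_form Q" UNIV] by simp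
qed

text \<open>For \<open>r \<noteq> 0\<close> and \<open>x\<close> in the radical, a square root
  \<open>a\<close> gives \<open>Q (a *s r) = Q x\<close>. Then
  \<open>Q (x + a *s r) = 2 * Q x = 0\<close>, and non-degeneracy makes \<open>x\<close> a multiple
  of \<open>r\<close>.\<close>

lemma dim_polar_radical_le_1:
  fixes Q :: "'b \<Rightarrow> 'a"
  assumes Q: "quadratic_form UNIV scale Q" and two: "(2 :: 'a) = 0"
    and sqrt: "\<And>c::'a. \<exists>a. a\<^sup>2 = c" and nd: "nondegenerate_quadratic_form Q"
  shows "dim {x. \<forall>y. polar_form Q x y = 0} \<le> 1"
proof (cases "{x. \<forall>y. polar_form Q x y = 0} \<subseteq> {0}")
  case True
  then have "dim {x. \<forall>y. polar_form Q x y = 0} = 0"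
    by (simp only: dim_eq_0)
  then show ?thesis
    by linarith
next
  case False
  then obtain r where r: "\<And>y. polar_form Q r y = 0" "r \<noteq> 0"
    by auto
  have Qr: "Q r \<noteq> 0"
    using nd r by (auto simp: nondegenerate_quadratic_form_def)
  have f: "sesquilinear_form UNIV scale id (polar_form Q)"
    using Q by (simp add: quadratic_form_def)
  have "x \<in> span {r}" if x: "\<And>y. polar_form Q x y = 0" for x
  proof -
    obtain a where a: "a\<^sup>2 = Q x / Q r"
      using sqrt by blast
    have "polar_form Q (a *s r) y = 0" for y
      using f r(1)[of y] unfolding sesquilinear_form_def
      by (metis UNIV_I mult_zero_right scale_one)
    then have z: "polar_form Q (x + a *s r) y = 0" for y
      using f x unfolding sesquilinear_form_def by (metis add_0)
    have "Q (x + a *s r) = Q x + Q (a *s r)"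
      using x[of "a *s r"] by (simp add: polar_form_def algebra_simps)
    also have "\<dots> = Q x + a\<^sup>2 * Q r"
      using Q by (simp add: quadratic_form_def)
    also have "\<dots> = 2 * Q x"
      using Qr a by simp
    finally have "x + a *s r = 0"
      using nd z two by (simp add: nondegenerate_quadratic_form_def)
    then have "x = (- a) *s r"
      by (simp add: eq_neg_iff_add_eq_0)
    then show ?thesis
      by (simp add: span_base span_scale span_neg)
  qed
  then have "dim {x. \<forall>y. polar_form Q x y = 0} \<le> card {r}"
    by (intro dim_le_card) auto
  then show ?thesis
    by simp
qed

text \<open>The radical has dimension at most 1, and parity rules out 1.\<close>

lemma nondegenerate_polar_form_if_even_dim:
  fixes Q :: "'b \<Rightarrow> 'a"
  assumes Q: "quadratic_form UNIV scale Q" and two: "(2 :: 'a) = 0"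
    and sqrt: "\<And>c::'a. \<exists>a. a\<^sup>2 = c" and nd: "nondegenerate_quadratic_form Q"
    and even: "even (dim (UNIV :: 'b set))"
  shows "nondegenerate_form (polar_form Q)"
proof -
  have "dim {x. \<forall>y. polar_form Q x y = 0} = 0"
    using dim_polar_radical_le_1[OF Q two sqrt nd] even_dim_polar_radical[OF Q two] even
    by (metis One_nat_def le_Suc_eq le_zero_eq odd_one)
  then show ?thesis
    by (auto simp: dim_eq_0 nondegenerate_form_def)
qed

text \<open>Odd parity yields \<open>u \<noteq> 0\<close> in the radical, and its multiples remain
  in the radical after composing with \<open>L\<close>. Either \<open>Q u = 0\<close> already, or a
  square root of \<open>c / Q u\<close> scales \<open>u\<close> to a vector with value
  \<open>c\<close> in the kernel of \<open>L\<close>.\<close>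

lemma degenerate_compose_if_odd_dim:
  fixes Q :: "'b \<Rightarrow> 'a" and L :: "'a \<Rightarrow> 'a"
  assumes Q: "quadratic_form UNIV scale Q" and two: "(2 :: 'a) = 0"
    and sqrt: "\<And>c::'a. \<exists>a. a\<^sup>2 = c" and odd: "odd (dim (UNIV :: 'b set))"
    and L: "linear_map_to_subfield F L" "L 0 = 0" and c: "c \<noteq> 0" "L c = 0"
  shows "\<not> nondegenerate_quadratic_form (\<lambda>u. L (Q u))"
proof -
  have "dim {x. \<forall>y. polar_form Q x y = 0} \<noteq> 0"
    using even_dim_polar_radical[OF Q two] odd by (metis even_zero)
  then obtain u where u: "\<And>y. polar_form Q u y = 0" "u \<noteq> 0"
    by (auto simp: dim_eq_0)
  have f: "sesquilinear_form UNIV scale id (polar_form Q)"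
    using Q by (simp add: quadratic_form_def)
  have au: "polar_form Q (a *s u) y = 0" for a y
    using f u(1)[of y] unfolding sesquilinear_form_def
    by (metis UNIV_I mult_zero_right scale_one)
  have "\<exists>a. a \<noteq> 0 \<and> L (Q (a *s u)) = 0"
  proof (cases "Q u = 0")
    case True
    then show ?thesis
      using L(2) by (intro exI[of _ 1]) simp
  next
    case False
    obtain a where a: "a\<^sup>2 = c / Q u"
      using sqrt by blast
    then have "Q (a *s u) = c"
      using Q False by (simp add: quadratic_form_def)
    moreover have "a \<noteq> 0"
      using a c(1) False by auto
    ultimately show ?thesis
      using c(2) by auto
  qed
  then obtain a where "a *s u \<noteq> 0" "L (Q (a *s u)) = 0"
    using u(2) by auto
  moreover have "polar_form (\<lambda>u. L (Q u)) (a *s u) y = 0" for y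
    by (simp add: polar_form_compose[OF L(1)] au L(2))
  ultimately show ?thesis
    by (auto simp: nondegenerate_quadratic_form_def)
qed

end

theorem theoremA:
  fixes scl :: "'k::field \<Rightarrow> 'v::ab_group_add \<Rightarrow> 'v"
    and \<sigma> :: "'k \<Rightarrow> 'k"
    and \<beta> :: "'v \<Rightarrow> 'v \<Rightarrow> 'k"
    and Q :: "'v \<Rightarrow> 'k"
    and F :: "'k set"
    and L :: "'k \<Rightarrow> 'k"
  assumes "vector_space scl"
    and "\<exists>v::'v. v \<noteq> 0"
    and "field_automorphism \<sigma>"
    and "sesquilinear_form UNIV scl \<sigma> \<beta>"
    and "reflexive_form \<beta>"
    and "quadratic_form UNIV scl Q"
    and "is_subfield F"
    and "\<sigma> ` F = F"
    and "linear_map_to_subfield F L"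
  shows "(nondegenerate_form (\<lambda>u v. L (\<beta> u v)) \<longleftrightarrow> nondegenerate_form \<beta> \<and> L \<noteq> (\<lambda>_. 0)) \<and>
         (CHAR('k) \<noteq> 2 \<or> (is_GF_two_power TYPE('k) \<and> even_dim scl) \<longrightarrow>
            (nondegenerate_quadratic_form (\<lambda>u. L (Q u)) \<longleftrightarrow>
               nondegenerate_quadratic_form Q \<and> L \<noteq> (\<lambda>_. 0))) \<and>
         (is_GF_two_power TYPE('k) \<and> odd_dim scl \<and> F \<noteq> UNIV \<longrightarrow>
            \<not> nondegenerate_quadratic_form (\<lambda>u. L (Q u)))"
proof (intro conjI impI)
  interpret vector_space scl
    by fact
  have L: "L (x + y) = L x + L y" for x y
    using assms(9) by (simp add: linear_map_to_subfield_def)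
  then interpret L: additive L
    by unfold_locales
  have "surj \<sigma>"
    using assms(3) by (simp add: field_automorphism_def bij_is_surj)
  then show "nondegenerate_form (\<lambda>u v. L (\<beta> u v)) \<longleftrightarrow> nondegenerate_form \<beta> \<and> L \<noteq> (\<lambda>_. 0)"
    using assms(2,4) L.zero by (intro nondegenerate_form_compose_iff)
  have f: "sesquilinear_form UNIV scl id (polar_form Q)"
    using assms(6) by (simp add: quadratic_form_def)
  {
    assume char: "CHAR('k) \<noteq> 2 \<or> is_GF_two_power TYPE('k) \<and> even_dim scl"
    \<comment> \<open>This reduces the quadratic claim to the criterion for sesquilinear forms,
      applied to the polar form with the identity automorphism.\<close>
    have polar: "nondegenerate_form (polar_form Q)" if nd: "nondegenerate_quadratic_form Q"
    proof (cases "CHAR('k) = 2")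
      case False
      then have "Q u = 0" if "\<forall>v. polar_form Q u v = 0" for u
        using that polar_form_self[OF assms(6), of u] by (simp add: CHAR_eq_2_iff)
      then show ?thesis
        using nd by (auto simp: nondegenerate_form_def nondegenerate_quadratic_form_def)
    next
      case True
      then have GF: "is_GF_two_power TYPE('k)" and dim: "even_dim scl"
        using char by auto
      obtain B where "finite_dimensional_vector_space scl B"
        using dim by (auto simp: even_dim_def finite_dim_def)
      then interpret finite_dimensional_vector_space scl B .
      have two: "(2 :: 'k) = 0"
        using True by (simp add: CHAR_eq_2_iff)
      show ?thesis
        using nd dim two finite_CHAR_2_square_root[OF is_GF_two_power_CHAR(1)[OF GF] two]
        by (intro nondegenerate_polar_form_if_even_dim[OF assms(6)]) (auto simp: even_dim_def)
    qed
    show "nondegenerate_quadratic_form (\<lambda>u. L (Q u)) \<longleftrightarrow>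
        nondegenerate_quadratic_form Q \<and> L \<noteq> (\<lambda>_. 0)"
    proof
      assume "nondegenerate_quadratic_form (\<lambda>u. L (Q u))"
      then show "nondegenerate_quadratic_form Q \<and> L \<noteq> (\<lambda>_. 0)"
        using nondegenerate_quadratic_form_composeD[OF assms(9) L.zero assms(2)] by blast
    next
      assume "nondegenerate_quadratic_form Q \<and> L \<noteq> (\<lambda>_. 0)"
      then have "nondegenerate_form (\<lambda>u v. L (polar_form Q u v))"
        using nondegenerate_form_compose_iff[OF f _ assms(2), where L = L] L.zero polar by simp
      then show "nondegenerate_quadratic_form (\<lambda>u. L (Q u))"
        by (intro nondegenerate_quadratic_form_if_polar) (simp add: polar_form_compose[OF assms(9)])
    qed
  }
  assume *: "is_GF_two_power TYPE('k) \<and> odd_dim scl \<and> F \<noteq> UNIV"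
  then have fin: "finite (UNIV :: 'k set)" and two: "(2 :: 'k) = 0"
    using is_GF_two_power_CHAR CHAR_eq_2_iff by blast+
  obtain B where "finite_dimensional_vector_space scl B"
    using * by (auto simp: odd_dim_def finite_dim_def)
  then interpret finite_dimensional_vector_space scl B .
  \<comment> \<open>The proper subfield supplies the kernel element: \<open>L\<close> takes values
    in \<open>F\<close>, so it is not onto, and on a finite field it is then not injective. By
    additivity, two points with equal image differ by a nonzero zero of \<open>L\<close>.\<close>
  have "\<not> surj L"
    using assms(9) * by (auto simp: linear_map_to_subfield_def)
  then have "\<not> inj L"
    using finite_UNIV_inj_surj[OF fin] by blast
  then obtain x y where "x - y \<noteq> 0" "L (x - y) = 0"
    by (auto simp: inj_def L.diff)
  then show "\<not> nondegenerate_quadratic_form (\<lambda>u. L (Q u))"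
    using * finite_CHAR_2_square_root[OF fin two] L.zero
    by (intro degenerate_compose_if_odd_dim[OF assms(6) two _ _ assms(9)])
      (auto simp: odd_dim_def)
qed

end
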